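(* Let $G$ be a finite group, $H \le G$ an abelian subgroup, and $\Omega \subseteq G$ a transversal for $G/H$. The map $Z_r \colon L^2(G) \to L^2(\hat H; L^2(\Omega))$ given by $$(Z_r f)(\alpha)(x) = \sum_{h\in H} f(xh)\,\alpha(h) \qquad (f \in L^2(G),\ \alpha\in\hat H,\ x \in \Omega)$$ is unitary, and it intertwines right $H$-translations with modulations: $Z_r(R_h f) = M_h (Z_r f)$ for all $h \in H$ and $f \in L^2(G)$.
   Context: $\hat H$ is the group of characters $\alpha\colon H \to \mathbb{T}$. A transversal for $G/H$ contains exactly one element of each left coset $xH$. $L^2(G)$ and $L^2(\Omega)$ are the spaces of complex functions with inner product $\langle f,g\rangle = \sum_x f(x)\overline{g(x)}$ (counting measure). $L^2(\hat H;L^2(\Omega))$ is the space of functions $\varphi\colon \hat H\to L^2(\Omega)$ with inner product $\langle\varphi,\psi\rangle = \frac{1}{|\hat H|}\sum_{\alpha\in\hat H}\langle\varphi(\alpha),\psi(\alpha)\rangle_{L^2(\Omega)}$. Right translation by $h\in H$ is $(R_h f)(x) = f(xh)$ for $f\in L^2(G)$, $x \in G$. Modulation by $h\in H$ on $L^2(\hat H;L^2(\Omega))$ is $(M_h \varphi)(\alpha) = \overline{\alpha(h)}\cdot\varphi(\alpha)$. *)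

theory Defs
  imports Complex_Main "HOL-Algebra.Left_Coset"
begin

text \<open>
  Functions on a set \<open>S\<close> are represented as elements of \<open>extensional S\<close>, so that
  two of them are equal iff they agree on \<open>S\<close>. The vector space operations
  therefore restrict their results to \<open>S\<close>.
\<close>

record 'v inner_space = "'v partial_object" +
  vadd :: "'v \<Rightarrow> 'v \<Rightarrow> 'v"
  vscale :: "complex \<Rightarrow> 'v \<Rightarrow> 'v"
  vinner :: "'v \<Rightarrow> 'v \<Rightarrow> complex"

definition L2 :: "'a set \<Rightarrow> ('a \<Rightarrow> complex) inner_space" where
  "L2 S = \<lparr>carrier = extensional S,
     vadd = (\<lambda>f g. \<lambda>x\<in>S. f x + g x),
     vscale = (\<lambda>c f. \<lambda>x\<in>S. c * f x),
     vinner = (\<lambda>f g. \<Sum>x\<in>S. f x * cnj (g x))\<rparr>"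

text \<open>Unlike \<open>L2\<close>, the vector-valued space \<open>L2_valued T V\<close> carries the normalized
  counting measure on \<open>T\<close>.\<close>

definition L2_valued :: "'t set \<Rightarrow> 'v inner_space \<Rightarrow> ('t \<Rightarrow> 'v) inner_space" where
  "L2_valued T V = \<lparr>carrier = (T \<rightarrow>\<^sub>E carrier V),
     vadd = (\<lambda>\<phi> \<psi>. \<lambda>t\<in>T. vadd V (\<phi> t) (\<psi> t)),
     vscale = (\<lambda>c \<phi>. \<lambda>t\<in>T. vscale V c (\<phi> t)),
     vinner = (\<lambda>\<phi> \<psi>. (1 / of_nat (card T)) * (\<Sum>t\<in>T. vinner V (\<phi> t) (\<psi> t)))\<rparr>"

definition linear_between :: "'v inner_space \<Rightarrow> 'w inner_space \<Rightarrow> ('v \<Rightarrow> 'w) \<Rightarrow> bool" where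
  "linear_between V W U \<longleftrightarrow>
     U \<in> carrier V \<rightarrow> carrier W \<and>
     (\<forall>u\<in>carrier V. \<forall>v\<in>carrier V. U (vadd V u v) = vadd W (U u) (U v)) \<and>
     (\<forall>c. \<forall>v\<in>carrier V. U (vscale V c v) = vscale W c (U v))"

definition unitary :: "'v inner_space \<Rightarrow> 'w inner_space \<Rightarrow> ('v \<Rightarrow> 'w) \<Rightarrow> bool" where
  "unitary V W U \<longleftrightarrow>
     linear_between V W U \<and>
     bij_betw U (carrier V) (carrier W) \<and>
     (\<forall>u\<in>carrier V. \<forall>v\<in>carrier V. vinner W (U u) (U v) = vinner V u v)"

definition circle_group :: "complex monoid" where
  "circle_group = \<lparr>carrier = {z. cmod z = 1}, mult = (*), one = 1\<rparr>"

definition dual_group :: "('a, 'b) monoid_scheme \<Rightarrow> ('a \<Rightarrow> complex) monoid" where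
  "dual_group K = \<lparr>carrier = hom K circle_group \<inter> extensional (carrier K),
     mult = (\<lambda>\<alpha> \<beta>. \<lambda>h\<in>carrier K. \<alpha> h * \<beta> h),
     one = (\<lambda>h\<in>carrier K. 1)\<rparr>"

abbreviation characters :: "('a, 'b) monoid_scheme \<Rightarrow> 'a set \<Rightarrow> ('a \<Rightarrow> complex) set" where
  "characters G H \<equiv> carrier (dual_group (G\<lparr>carrier := H\<rparr>))"

definition left_transversal :: "('a, 'b) monoid_scheme \<Rightarrow> 'a set \<Rightarrow> 'a set \<Rightarrow> bool" where
  "left_transversal G H \<Omega> \<longleftrightarrow>
     \<Omega> \<subseteq> carrier G \<and> (\<forall>C\<in>lcosets\<^bsub>G\<^esub> H. \<exists>!x. x \<in> \<Omega> \<inter> C)"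

definition right_translation ::
    "('a, 'b) monoid_scheme \<Rightarrow> 'a \<Rightarrow> ('a \<Rightarrow> complex) \<Rightarrow> 'a \<Rightarrow> complex" where
  "right_translation G h f = (\<lambda>x\<in>carrier G. f (x \<otimes>\<^bsub>G\<^esub> h))"

definition modulation ::
    "('a, 'b) monoid_scheme \<Rightarrow> 'a set \<Rightarrow> 'a set \<Rightarrow> 'a \<Rightarrow>
     (('a \<Rightarrow> complex) \<Rightarrow> 'a \<Rightarrow> complex) \<Rightarrow> ('a \<Rightarrow> complex) \<Rightarrow> 'a \<Rightarrow> complex" where
  "modulation G H \<Omega> h \<phi> = (\<lambda>\<alpha>\<in>characters G H. vscale (L2 \<Omega>) (cnj (\<alpha> h)) (\<phi> \<alpha>))"

definition right_zak ::
    "('a, 'b) monoid_scheme \<Rightarrow> 'a set \<Rightarrow> 'a set \<Rightarrow>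
     ('a \<Rightarrow> complex) \<Rightarrow> ('a \<Rightarrow> complex) \<Rightarrow> 'a \<Rightarrow> complex" where
  "right_zak G H \<Omega> f =
     (\<lambda>\<alpha>\<in>characters G H. \<lambda>x\<in>\<Omega>. \<Sum>h\<in>H. f (x \<otimes>\<^bsub>G\<^esub> h) * \<alpha> h)"

end

theory Submission
  imports Defs "HOL-Algebra.Multiplicative_Group"
begin

text \<open>
  Parametrizing \<open>G\<close> by \<open>\<Omega> \<times> H\<close> via \<open>(x, h) \<mapsto> x h\<close>, the map \<open>Z\<^sub>r\<close> acts on each fibre \<open>x H\<close> as a
  Fourier transform on \<open>H\<close>. It preserves inner products by the orthogonality of the columns of the
  character table of \<open>H\<close>, and it is inverted using the orthogonality of the rows. Column
  orthogonality needs enough characters to separate the points of \<open>H\<close>; these come from simultaneous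
  eigenfunctions of the commuting translation operators, which have finite order. Any such
  nonzero eigenfunction is proportional to the character formed by its eigenvalues.
\<close>

section \<open>Characters of a group and finiteness of the dual\<close>

lemma dual_group_carrier_iff:
  "\<chi> \<in> carrier (dual_group K) \<longleftrightarrow> \<chi> \<in> extensional (carrier K) \<and>
     (\<forall>x\<in>carrier K. cmod (\<chi> x) = 1) \<and>
     (\<forall>x\<in>carrier K. \<forall>y\<in>carrier K. \<chi> (x \<otimes>\<^bsub>K\<^esub> y) = \<chi> x * \<chi> y)"
  by (auto simp: dual_group_def circle_group_def hom_def)

lemma (in group) character_one:
  assumes "\<chi> \<in> carrier (dual_group G)"
  shows "\<chi> \<one> = 1"
proof -
  have "cmod (\<chi> \<one>) = 1" "\<chi> \<one> = \<chi> \<one> * \<chi> \<one>"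
    using assms by (metis dual_group_carrier_iff one_closed r_one)+
  then show ?thesis by (metis mult_cancel_left1 norm_zero zero_neq_one)
qed

lemma (in group) character_inv:
  assumes "\<chi> \<in> carrier (dual_group G)" "x \<in> carrier G"
  shows "\<chi> (inv x) = cnj (\<chi> x)"
proof -
  have 1: "\<chi> x * \<chi> (inv x) = 1"
    using assms character_one[OF assms(1)]
    by (metis dual_group_carrier_iff inv_closed r_inv)
  have "\<chi> x * cnj (\<chi> x) = 1"
    using assms by (simp add: dual_group_carrier_iff complex_norm_square [symmetric])
  with 1 show ?thesis by (metis mult.left_commute mult.right_neutral)
qed

lemma (in group) character_pow:
  assumes "\<chi> \<in> carrier (dual_group G)" "x \<in> carrier G"
  shows "\<chi> (x [^] (n::nat)) = \<chi> x ^ n"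
  using assms by (induction n) (auto simp: character_one dual_group_carrier_iff)

text \<open>Every element has order dividing the group order, so characters take values in the
  finite set of \<open>order G\<close>-th roots of unity. Finiteness is what later lets sums over
  the dual group collapse to a single term.\<close>

lemma (in group) finite_dual_group:
  assumes "finite (carrier G)"
  shows "finite (carrier (dual_group G))"
proof -
  have "order G \<ge> 1" using assms order_gt_0_iff_finite by simp
  moreover have "\<chi> x ^ order G = 1"
    if "\<chi> \<in> carrier (dual_group G)" "x \<in> carrier G" for \<chi> x
    using that by (metis character_one character_pow pow_order_eq_1)
  ultimately have "carrier (dual_group G) \<subseteq> (carrier G \<rightarrow>\<^sub>E {z. z ^ order G = 1})"
    by (intro subsetI) (simp add: PiE_iff dual_group_carrier_iff)
  moreover have "finite (carrier G \<rightarrow>\<^sub>E {z::complex. z ^ order G = 1})"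
    using assms \<open>order G \<ge> 1\<close> by (intro finite_PiE finite_roots_unity) auto
  ultimately show ?thesis by (rule finite_subset)
qed

section \<open>Roots of unity, eigenfunctions of translations, and separation of points\<close>

lemma root_of_unity_pow_eq_1_iff:
  assumes "0 < N" "j < N"
  shows "cis (2 * pi / real N) ^ j = 1 \<longleftrightarrow> j = 0"
proof -
  have inj: "inj_on (\<lambda>k. cis (2 * pi * real k / real N)) {..<N}"
    using bij_betw_roots_unity[OF assms(1)] by (simp add: bij_betw_def)
  have "cis (2 * pi / real N) ^ j = cis (2 * pi * real j / real N)"
    by (simp add: DeMoivre mult.commute)
  then show ?thesis using inj_onD[OF inj, of j 0] assms by auto
qed

lemma sum_powers_root_of_unity:
  fixes z :: complex
  assumes "z ^ N = 1"
  shows "(\<Sum>k<N. z ^ k) = (if z = 1 then of_nat N else 0)"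
  using assms by (simp add: geometric_sum)

text \<open>Shifting the summation index by one multiplies the sum by \<zeta>; the boundary terms at
  \<open>0\<close> and \<open>N\<close> agree because both \<zeta> and \<open>g\<close> have trivial
  \<open>N\<close>-th power. Up to the factor \<open>N\<close>, the sum is the projection of
  \<open>f\<close> onto the eigenspace of translation by \<open>g\<close> with eigenvalue
  \<open>inverse \<zeta>\<close>.\<close>

lemma (in group) averaged_eigenfunction:
  fixes f :: "'a \<Rightarrow> complex"
  assumes "g \<in> carrier G" "g [^] (N::nat) = \<one>" "\<zeta> ^ N = 1" "0 < N" "x \<in> carrier G"
  shows "(\<Sum>j<N. \<zeta> ^ j * f (x \<otimes> g \<otimes> g [^] j)) = inverse \<zeta> * (\<Sum>j<N. \<zeta> ^ j * f (x \<otimes> g [^] j))"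
proof -
  let ?F = "\<lambda>j. \<zeta> ^ j * f (x \<otimes> g [^] j)"
  have nz: "\<zeta> \<noteq> 0" using assms by (auto simp: power_0_left)
  have "\<zeta> * (\<Sum>j<N. \<zeta> ^ j * f (x \<otimes> g \<otimes> g [^] j)) = (\<Sum>j<N. ?F (Suc j))"
    unfolding sum_distrib_left
    by (rule sum.cong) (use assms in \<open>simp_all add: m_assoc nat_pow_Suc2 [symmetric] mult.assoc del: nat_pow_Suc\<close>)
  also have "\<dots> = (\<Sum>j<N. ?F j)"
    using sum.lessThan_Suc_shift[of ?F N] sum.lessThan_Suc[of ?F N] assms by simp
  finally show ?thesis using nz by (simp add: field_simps)
qed

text \<open>Induction on \<open>S\<close>: a nontrivial eigenvalue for \<open>h\<close> is secured
  first, and each new \<open>g\<close> is treated by projecting onto an eigenspace of translation by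
  \<open>g\<close> on which the function does not vanish.\<close>

lemma (in comm_group) simultaneous_eigenfunction:
  assumes fin: "finite (carrier G)" and h: "h \<in> carrier G" "h \<noteq> \<one>"
    and "finite S" "S \<subseteq> carrier G"
  shows "\<exists>(f :: 'a \<Rightarrow> complex) \<zeta>. (\<exists>x\<in>carrier G. f x \<noteq> 0) \<and> \<zeta> \<noteq> 1 \<and>
     (\<forall>x\<in>carrier G. f (x \<otimes> h) = \<zeta> * f x) \<and>
     (\<forall>g\<in>S. \<exists>c. \<forall>x\<in>carrier G. f (x \<otimes> g) = c * f x)"
  using assms(4,5)
proof (induction S rule: finite_induct)
  case empty
  let ?N = "ord h"
  have N: "0 < ?N" "?N \<noteq> 1"
    using ord_ge_1[OF fin h(1)] ord_eq_1[OF h(1)] h(2) by auto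
  define \<omega> where "\<omega> = cis (2 * pi / real ?N)"
  have \<omega>: "\<omega> ^ ?N = 1" "\<omega> \<noteq> 1"
    using root_of_unity_pow_eq_1_iff[OF N(1), of 1] N by (auto simp: \<omega>_def DeMoivre)
  \<comment> \<open>This is the indicator of \<one> projected, up to a factor, onto an eigenspace of
    translation by \<open>h\<close>. At \<one> only \<open>j = 0\<close> survives, since no smaller
    positive power of \<open>h\<close> is trivial; hence the projection is nonzero.\<close>
  define f where "f = (\<lambda>x. \<Sum>j<?N. \<omega> ^ j * (if x \<otimes> h [^] j = \<one> then 1 else 0))"
  have "f (x \<otimes> h) = inverse \<omega> * f x" if "x \<in> carrier G" for x
    unfolding f_def
    by (rule averaged_eigenfunction) (use h \<omega> N that in auto)
  moreover have "f \<one> = 1"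
  proof -
    have "\<one> \<otimes> h [^] j = \<one> \<longleftrightarrow> j = 0" if "j < ?N" for j
      using h(1) that by (auto simp: pow_eq_id dest: dvd_imp_le)
    then have "f \<one> = (\<Sum>j<?N. if j = 0 then 1 else 0)"
      unfolding f_def by (intro sum.cong) auto
    then show ?thesis using N by simp
  qed
  ultimately show ?case
    using \<omega> by (intro exI[of _ f] exI[of _ "inverse \<omega>"]) (auto intro!: bexI[of _ \<one>])
next
  case (insert g S)
  then obtain f \<zeta> x where f: "x \<in> carrier G" "f x \<noteq> (0::complex)" "\<zeta> \<noteq> 1"
      "\<And>x. x \<in> carrier G \<Longrightarrow> f (x \<otimes> h) = \<zeta> * f x"
      "\<And>g. g \<in> S \<Longrightarrow> \<exists>c. \<forall>x\<in>carrier G. f (x \<otimes> g) = c * f x"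
    by auto
  have g: "g \<in> carrier G" and S: "S \<subseteq> carrier G" using insert.prems by auto
  let ?N = "order G"
  have N: "0 < ?N" using fin order_gt_0_iff_finite by simp
  define \<omega> where "\<omega> = cis (2 * pi / real ?N)"
  \<comment> \<open>The components of \<open>f\<close> in the eigenspaces of translation by
    \<open>g\<close>, scaled by \<open>?N\<close>. They add up to \<open>?N\<close> times
    \<open>f\<close>, since summing over \<open>k\<close> first leaves only \<open>j = 0\<close>; so
    some component is nonzero at \<open>x\<close>.\<close>
  define F where "F = (\<lambda>k y. \<Sum>j<?N. (\<omega> ^ k) ^ j * f (y \<otimes> g [^] j))"
  have \<omega>: "\<omega> ^ ?N = 1" using N by (auto simp: \<omega>_def DeMoivre)
  have "(\<Sum>k<?N. F k x) = (\<Sum>j<?N. (\<Sum>k<?N. (\<omega> ^ j) ^ k) * f (x \<otimes> g [^] j))"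
    unfolding F_def by (subst sum.swap) (simp add: sum_distrib_right mult.commute[of _ "_ :: nat"] flip: power_mult)
  also have "\<dots> = (\<Sum>j<?N. if j = 0 then of_nat ?N * f x else 0)"
  proof (rule sum.cong)
    fix j assume "j \<in> {..<?N}"
    then have "\<omega> ^ j = 1 \<longleftrightarrow> j = 0"
      using root_of_unity_pow_eq_1_iff[OF N] by (simp add: \<omega>_def)
    moreover have "(\<omega> ^ j) ^ ?N = 1"
      using \<omega> by (metis mult.commute power_mult power_one)
    ultimately show "(\<Sum>k<?N. (\<omega> ^ j) ^ k) * f (x \<otimes> g [^] j) = (if j = 0 then of_nat ?N * f x else 0)"
      using f(1) by (simp add: sum_powers_root_of_unity)
  qed simp
  finally have "(\<Sum>k<?N. F k x) \<noteq> 0" using f(2) N by simp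
  then obtain k where k: "F k x \<noteq> 0" by (meson sum.neutral)
  \<comment> \<open>Averaging over the powers of \<open>g\<close> keeps the eigenvalues that \<open>f\<close> already has, as \<open>G\<close> is abelian.\<close>
  have transfer: "F k (y \<otimes> a) = c * F k y"
    if a: "a \<in> carrier G" "\<forall>y\<in>carrier G. f (y \<otimes> a) = c * f y" and y: "y \<in> carrier G" for a c y
  proof -
    have "f (y \<otimes> a \<otimes> g [^] j) = c * f (y \<otimes> g [^] j)" for j :: nat
    proof -
      have "y \<otimes> a \<otimes> g [^] j = y \<otimes> g [^] j \<otimes> a"
        using a(1) y g by (simp add: m_assoc m_comm)
      then show ?thesis using a y g by simp
    qed
    then show ?thesis by (simp add: F_def sum_distrib_left mult.left_commute)
  qed
  have "F k (y \<otimes> g) = inverse (\<omega> ^ k) * F k y" if "y \<in> carrier G" for y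
    unfolding F_def
    by (rule averaged_eigenfunction) (use g N \<omega> that pow_order_eq_1 in \<open>auto simp: power_mult [symmetric] mult.commute[of k] power_mult\<close>)
  then have "\<exists>c. \<forall>y\<in>carrier G. F k (y \<otimes> a) = c * F k y" if "a \<in> insert g S" for a
    using that f(5) S transfer by (metis insertE subsetD)
  moreover have "\<forall>y\<in>carrier G. F k (y \<otimes> h) = \<zeta> * F k y"
    using transfer h f(4) by blast
  ultimately show ?case
    using k f(1,3) by (intro exI[of _ "F k"] exI[of _ \<zeta>]) blast
qed

lemma (in comm_group) characters_separate_points:
  assumes fin: "finite (carrier G)" and h: "h \<in> carrier G" "h \<noteq> \<one>"
  obtains \<chi> where "\<chi> \<in> carrier (dual_group G)" "\<chi> h \<noteq> 1"
proof -
  obtain f \<zeta> x where f: "x \<in> carrier G" "f x \<noteq> (0::complex)" "\<zeta> \<noteq> 1"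
      "\<And>x. x \<in> carrier G \<Longrightarrow> f (x \<otimes> h) = \<zeta> * f x"
      "\<And>g. g \<in> carrier G \<Longrightarrow> \<exists>c. \<forall>x\<in>carrier G. f (x \<otimes> g) = c * f x"
    using simultaneous_eigenfunction[OF fin h fin order.refl] by blast
  obtain c where c: "\<And>g x. g \<in> carrier G \<Longrightarrow> x \<in> carrier G \<Longrightarrow> f (x \<otimes> g) = c g * f x"
    using f(5) by metis
  \<comment> \<open>The value at \<open>x\<close> is a multiple of the value at \<one>, so the
    latter cannot vanish. Cancelling it turns identities for \<open>f\<close> into identities for
    the eigenvalues \<open>c\<close>.\<close>
  have f1: "f \<one> \<noteq> 0" using c[OF f(1) one_closed] f(1,2) by auto
  have c_mult: "c (a \<otimes> b) = c a * c b" if "a \<in> carrier G" "b \<in> carrier G" for a b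
  proof -
    have "c (a \<otimes> b) * f \<one> = f (a \<otimes> b)"
      using c[of "a \<otimes> b" \<one>] that by simp
    also have "\<dots> = c b * (c a * f \<one>)" using c[of b a] c[of a \<one>] that by simp
    finally show ?thesis using f1 by simp
  qed
  have c1: "c \<one> = 1" using c[of \<one> \<one>] f1 by simp
  have "c (a [^] n) = c a ^ n" if "a \<in> carrier G" for a and n :: nat
    using that by (induction n) (auto simp: c1 c_mult)
  \<comment> \<open>Finite order makes each eigenvalue a root of unity, hence a point of the
    circle.\<close>
  then have "c a ^ order G = 1" if "a \<in> carrier G" for a
    using that c1 pow_order_eq_1 by metis
  then have "cmod (c a) ^ order G = 1" if "a \<in> carrier G" for a
    using that by (metis norm_one norm_power)
  moreover have "0 < order G" using fin order_gt_0_iff_finite by simp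
  ultimately have cmod: "cmod (c a) = 1" if "a \<in> carrier G" for a
    using power_eq_imp_eq_base[of "cmod (c a)" "order G" 1] that by simp
  show ?thesis
  proof
    show "restrict c (carrier G) \<in> carrier (dual_group G)"
      using cmod c_mult by (simp add: dual_group_carrier_iff)
    show "restrict c (carrier G) h \<noteq> 1"
      using f(3) f(4)[of \<one>] c[of h \<one>] h(1) f1 by simp
  qed
qed

section \<open>Orthogonality relations for characters\<close>

lemma (in group) sum_character:
  assumes \<chi>: "\<chi> \<in> carrier (dual_group G)"
  shows "(\<Sum>x\<in>carrier G. \<chi> x) = (if \<chi> = \<one>\<^bsub>dual_group G\<^esub> then of_nat (order G) else 0)"
proof (cases "\<chi> = \<one>\<^bsub>dual_group G\<^esub>")
  case True
  then show ?thesis by (simp add: dual_group_def order_def)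
next
  case False
  have "\<exists>a\<in>carrier G. \<chi> a \<noteq> 1"
  proof (rule ccontr)
    assume "\<not> ?thesis"
    then have "\<chi> = \<one>\<^bsub>dual_group G\<^esub>"
      using \<chi> by (auto simp: dual_group_def extensional_def fun_eq_iff)
    with False show False by simp
  qed
  then obtain a where a: "a \<in> carrier G" "\<chi> a \<noteq> 1" by blast
  \<comment> \<open>Translation by \<open>a\<close> permutes the group and multiplies the sum by
    \<chi>\<open>(a)\<close>, which differs from 1; so the sum is 0.\<close>
  have "bij_betw (\<lambda>x. a \<otimes> x) (carrier G) (carrier G)"
    by (rule bij_betw_byWitness[where f' = "\<lambda>x. inv a \<otimes> x"]) (use a in \<open>auto simp: m_assoc [symmetric]\<close>)
  then have "(\<Sum>x\<in>carrier G. \<chi> x) = (\<Sum>x\<in>carrier G. \<chi> (a \<otimes> x))"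
    using sum.reindex_bij_betw[of _ _ _ \<chi>] by metis
  also have "\<dots> = \<chi> a * (\<Sum>x\<in>carrier G. \<chi> x)"
    using \<chi> a by (simp add: sum_distrib_left dual_group_carrier_iff)
  finally show ?thesis using a False by simp
qed

lemma (in group) character_orthogonality:
  assumes "\<chi> \<in> carrier (dual_group G)" "\<psi> \<in> carrier (dual_group G)"
  shows "(\<Sum>x\<in>carrier G. \<chi> x * cnj (\<psi> x)) = (if \<chi> = \<psi> then of_nat (order G) else 0)"
proof -
  \<comment> \<open>The quotient of the two characters is again a character, and it is trivial
    exactly when they coincide.\<close>
  let ?\<eta> = "\<lambda>x\<in>carrier G. \<chi> x * cnj (\<psi> x)"
  have "?\<eta> \<in> carrier (dual_group G)"
    using assms by (auto simp: dual_group_carrier_iff norm_mult)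
  moreover have "?\<eta> = \<one>\<^bsub>dual_group G\<^esub> \<longleftrightarrow> \<chi> = \<psi>"
  proof -
    have "\<chi> x * cnj (\<psi> x) = 1 \<longleftrightarrow> \<chi> x = \<psi> x" if "x \<in> carrier G" for x
    proof -
      have "\<psi> x * cnj (\<psi> x) = 1"
        using assms that by (simp add: dual_group_carrier_iff complex_norm_square [symmetric])
      then show ?thesis by (metis mult_cancel_right mult_zero_right zero_neq_one)
    qed
    then have "?\<eta> = \<one>\<^bsub>dual_group G\<^esub> \<longleftrightarrow> (\<forall>x\<in>carrier G. \<chi> x = \<psi> x)"
      by (auto simp: dual_group_def restrict_def fun_eq_iff)
    also have "\<dots> \<longleftrightarrow> \<chi> = \<psi>"
      using assms by (auto simp: dual_group_carrier_iff intro: extensionalityI)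
    finally show ?thesis .
  qed
  ultimately show ?thesis using sum_character[of ?\<eta>] by simp
qed

text \<open>Multiplication by a character \<psi> with \<psi>\<open>(h)\<close> different from 1
  permutes the dual, with multiplication by the conjugate as its inverse, and scales the sum by
  \<psi>\<open>(h)\<close>. Separation of points supplies such a \<psi>.\<close>

lemma (in comm_group) sum_dual_group_eq_0:
  assumes fin: "finite (carrier G)" and h: "h \<in> carrier G" "h \<noteq> \<one>"
  shows "(\<Sum>\<chi>\<in>carrier (dual_group G). \<chi> h) = 0"
proof -
  obtain \<psi> where \<psi>: "\<psi> \<in> carrier (dual_group G)" "\<psi> h \<noteq> 1"
    using characters_separate_points[OF fin h] .
  have "\<psi> x * cnj (\<psi> x) = 1" if "x \<in> carrier G" for x
    using \<psi> that by (simp add: dual_group_carrier_iff complex_norm_square [symmetric])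
  then have \<psi>1: "\<psi> x * (cnj (\<psi> x) * z) = z" "cnj (\<psi> x) * (\<psi> x * z) = z" if "x \<in> carrier G" for x z
    using that by (metis mult.assoc mult.commute mult_1)+
  have "bij_betw (\<lambda>\<chi>. \<lambda>x\<in>carrier G. \<psi> x * \<chi> x) (carrier (dual_group G)) (carrier (dual_group G))"
  proof (rule bij_betw_byWitness[where f' = "\<lambda>\<chi>. \<lambda>x\<in>carrier G. cnj (\<psi> x) * \<chi> x"])
    show "\<forall>\<chi>\<in>carrier (dual_group G).
        (\<lambda>x\<in>carrier G. cnj (\<psi> x) * (\<lambda>x\<in>carrier G. \<psi> x * \<chi> x) x) = \<chi>"
      by (intro ballI extensionalityI[where A = "carrier G"]) (simp_all add: \<psi>1 dual_group_carrier_iff)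
    show "\<forall>\<chi>\<in>carrier (dual_group G).
        (\<lambda>x\<in>carrier G. \<psi> x * (\<lambda>x\<in>carrier G. cnj (\<psi> x) * \<chi> x) x) = \<chi>"
      by (intro ballI extensionalityI[where A = "carrier G"]) (simp_all add: \<psi>1 dual_group_carrier_iff)
  qed (use \<psi> in \<open>auto simp: dual_group_carrier_iff norm_mult\<close>)
  then have "(\<Sum>\<chi>\<in>carrier (dual_group G). \<chi> h) =
      (\<Sum>\<chi>\<in>carrier (dual_group G). (\<lambda>x\<in>carrier G. \<psi> x * \<chi> x) h)"
    using sum.reindex_bij_betw[of _ _ _ "\<lambda>\<chi>. \<chi> h"] by metis
  also have "\<dots> = \<psi> h * (\<Sum>\<chi>\<in>carrier (dual_group G). \<chi> h)"
    using h by (simp add: sum_distrib_left)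
  finally show ?thesis using \<psi> by simp
qed

text \<open>Sum the whole character table in two ways: by columns only \<one> contributes, by rows
  only the trivial character does.\<close>

lemma (in comm_group) card_dual_group:
  assumes fin: "finite (carrier G)"
  shows "card (carrier (dual_group G)) = order G"
proof -
  note finD = finite_dual_group[OF fin]
  have one: "\<one>\<^bsub>dual_group G\<^esub> \<in> carrier (dual_group G)"
    by (auto simp: dual_group_carrier_iff) (auto simp: dual_group_def)
  have "(\<Sum>h\<in>carrier G. \<Sum>\<chi>\<in>carrier (dual_group G). \<chi> h) =
      (\<Sum>h\<in>carrier G. if h = \<one> then of_nat (card (carrier (dual_group G))) else 0)"
    by (rule sum.cong) (auto simp: sum_dual_group_eq_0[OF fin] character_one)
  also have "\<dots> = of_nat (card (carrier (dual_group G)))" using fin by simp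
  finally have "of_nat (card (carrier (dual_group G))) =
      (\<Sum>\<chi>\<in>carrier (dual_group G). \<Sum>h\<in>carrier G. \<chi> h)"
    by (simp add: sum.swap[of _ "carrier G"])
  also have "\<dots> = of_nat (order G)"
    using finD one by (simp add: sum_character)
  finally show ?thesis using of_nat_eq_iff by blast
qed

text \<open>Conjugation inverts the argument, so this is the column sum at
  \<open>h \<otimes> inv k\<close>; the diagonal value comes from
  \<open>card_dual_group\<close>.\<close>

lemma (in comm_group) dual_orthogonality:
  assumes fin: "finite (carrier G)" and "h \<in> carrier G" "k \<in> carrier G"
  shows "(\<Sum>\<chi>\<in>carrier (dual_group G). \<chi> h * cnj (\<chi> k)) = (if h = k then of_nat (order G) else 0)"
proof -
  have "(\<Sum>\<chi>\<in>carrier (dual_group G). \<chi> h * cnj (\<chi> k)) = (\<Sum>\<chi>\<in>carrier (dual_group G). \<chi> (h \<otimes> inv k))"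
    using assms by (intro sum.cong) (auto simp: character_inv [symmetric] dual_group_carrier_iff)
  also have "\<dots> = (if h \<otimes> inv k = \<one> then of_nat (order G) else 0)"
    using assms by (auto simp: sum_dual_group_eq_0[OF fin] character_one card_dual_group[OF fin])
  also have "h \<otimes> inv k = \<one> \<longleftrightarrow> h = k"
    using assms by (metis inv_closed inv_inv inv_equality r_inv)
  finally show ?thesis .
qed

section \<open>Factorization of a group along a transversal\<close>

lemma (in group) bij_betw_transversal:
  assumes H: "subgroup H G" and \<Omega>: "left_transversal G H \<Omega>"
  shows "bij_betw (\<lambda>(x, h). x \<otimes> h) (\<Omega> \<times> H) (carrier G)"
proof (rule bij_betw_imageI)
  have sub: "\<Omega> \<subseteq> carrier G" "H \<subseteq> carrier G"
    using \<Omega> subgroup.subset[OF H] unfolding left_transversal_def by blast+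
  have ex1: "\<exists>!x. x \<in> \<Omega> \<inter> (g <# H)" if "g \<in> carrier G" for g
  proof -
    have "g <# H \<in> lcosets H" using that by (auto simp: LCOSETS_def)
    then show ?thesis using \<Omega> unfolding left_transversal_def by blast
  qed
  show "inj_on (\<lambda>(x, h). x \<otimes> h) (\<Omega> \<times> H)"
  proof (intro inj_onI; clarsimp)
    fix x h y k
    assume *: "x \<in> \<Omega>" "h \<in> H" "y \<in> \<Omega>" "k \<in> H" "x \<otimes> h = y \<otimes> k"
    \<comment> \<open>Equal products put \<open>x\<close> and \<open>y\<close> in one left coset,
      which has a single representative.\<close>
    have "x = y \<otimes> (k \<otimes> inv h)"
    proof -
      have "x \<in> carrier G" "h \<in> carrier G" "y \<in> carrier G" "k \<in> carrier G"
        using * sub by auto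
      then show ?thesis
        using *(5) by (simp add: m_assoc [symmetric] inv_solve_right flip: *(5))
    qed
    then have "x \<in> y <# H"
      using * H by (auto simp: l_coset_def subgroup.m_closed subgroup.m_inv_closed)
    moreover have "y \<in> y <# H"
      using * sub subgroup.one_closed[OF H] by (force simp: l_coset_def)
    ultimately have "x = y" using ex1[of y] * sub by blast
    then show "x = y \<and> h = k" using * sub by (auto simp: subset_iff)
  qed
  show "(\<lambda>(x, h). x \<otimes> h) ` (\<Omega> \<times> H) = carrier G"
  proof (intro equalityI subsetI)
    fix g assume g: "g \<in> carrier G"
    \<comment> \<open>The representative of the coset of \<open>g\<close> is
      \<open>g \<otimes> h\<close> for some \<open>h\<close> in \<open>H\<close>, so the second
      coordinate of \<open>g\<close> is \<open>inv h\<close>.\<close>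
    then obtain x h where x: "x \<in> \<Omega>" "h \<in> H" "x = g \<otimes> h"
      using ex1[OF g] by (auto simp: l_coset_def)
    then have "g = x \<otimes> inv h"
      using sub g by (auto simp: m_assoc)
    then show "g \<in> (\<lambda>(x, h). x \<otimes> h) ` (\<Omega> \<times> H)"
      using x subgroup.m_inv_closed[OF H] by (auto intro!: image_eqI[of _ _ "(x, inv h)"])
  qed (use sub in auto)
qed

section \<open>Unitarity and intertwining property of the right Zak transform\<close>

theorem theorem2:
  fixes G :: "('a, 'b) monoid_scheme" and H \<Omega> :: "'a set"
  assumes "group G" and "finite (carrier G)"
    and "subgroup H G" and "comm_group (G\<lparr>carrier := H\<rparr>)"
    and "left_transversal G H \<Omega>"
  shows "unitary (L2 (carrier G)) (L2_valued (characters G H) (L2 \<Omega>)) (right_zak G H \<Omega>) \<and>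
    (\<forall>h\<in>H. \<forall>f\<in>carrier (L2 (carrier G)).
       right_zak G H \<Omega> (right_translation G h f) = modulation G H \<Omega> h (right_zak G H \<Omega> f))"
proof -
  interpret group G by fact
  interpret K: comm_group "G\<lparr>carrier := H\<rparr>" by fact
  let ?Z = "right_zak G H \<Omega>" and ?D = "characters G H"
  let ?V = "L2 (carrier G)" and ?W = "L2_valued ?D (L2 \<Omega>)"
  note L2_defs = L2_def L2_valued_def
  have sub: "\<Omega> \<subseteq> carrier G" "H \<subseteq> carrier G"
    using assms(5) subgroup.subset[OF assms(3)] unfolding left_transversal_def by blast+
  have mem: "x \<otimes>\<^bsub>G\<^esub> h \<in> carrier G" if "x \<in> \<Omega>" "h \<in> H" for x h using that sub by auto
  have finH: "finite H" using sub assms(2) finite_subset by blast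
  then have finK: "finite (carrier (G\<lparr>carrier := H\<rparr>))" by simp
  \<comment> \<open>This makes the normalization of \<open>L2_valued\<close> cancel the factor
    \<open>card H\<close> produced by \<open>dual_orth\<close>.\<close>
  have cardD: "card ?D = card H" using K.card_dual_group[OF finK] by (simp add: order_def)
  have H0: "card H \<noteq> 0" using finH subgroup.one_closed[OF assms(3)] by auto
  have bij: "bij_betw (\<lambda>(x, h). x \<otimes>\<^bsub>G\<^esub> h) (\<Omega> \<times> H) (carrier G)"
    by (rule bij_betw_transversal) fact+
  have orth: "(\<Sum>h\<in>H. \<alpha> h * cnj (\<beta> h)) = (if \<alpha> = \<beta> then of_nat (card H) else 0)"
    if "\<alpha> \<in> ?D" "\<beta> \<in> ?D" for \<alpha> \<beta>
    using K.character_orthogonality[OF that] by (simp add: order_def)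
  have dual_orth: "(\<Sum>\<alpha>\<in>?D. \<alpha> h * cnj (\<alpha> k)) = (if h = k then of_nat (card H) else 0)"
    if "h \<in> H" "k \<in> H" for h k
    using K.dual_orthogonality[OF finK] that by (simp add: order_def)
  have Z_apply: "?Z f \<alpha> x = (\<Sum>h\<in>H. f (x \<otimes>\<^bsub>G\<^esub> h) * \<alpha> h)" if "\<alpha> \<in> ?D" "x \<in> \<Omega>" for f \<alpha> x
    using that by (simp add: right_zak_def)

  \<comment> \<open>Both sides only evaluate \<open>f\<close> and \<open>g\<close> on
    \<open>carrier G\<close>, so the identity covers arbitrary functions. Injectivity applies it to
    a pointwise difference that is not restricted to \<open>carrier G\<close>.\<close>
  have inner: "vinner ?W (?Z f) (?Z g) = vinner ?V f g" for f g
  proof -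
    \<comment> \<open>Parseval's identity on the fibre \<open>x H\<close>: column orthogonality
      keeps only the diagonal of the double sum.\<close>
    have fiber: "(\<Sum>\<alpha>\<in>?D. ?Z f \<alpha> x * cnj (?Z g \<alpha> x)) = of_nat (card H) * (\<Sum>h\<in>H. f (x \<otimes>\<^bsub>G\<^esub> h) * cnj (g (x \<otimes>\<^bsub>G\<^esub> h)))"
      if "x \<in> \<Omega>" for x
    proof -
      have "(\<Sum>\<alpha>\<in>?D. ?Z f \<alpha> x * cnj (?Z g \<alpha> x)) =
          (\<Sum>\<alpha>\<in>?D. \<Sum>h\<in>H. \<Sum>k\<in>H. f (x \<otimes>\<^bsub>G\<^esub> h) * cnj (g (x \<otimes>\<^bsub>G\<^esub> k)) * (\<alpha> h * cnj (\<alpha> k)))"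
        using that by (simp add: Z_apply sum_product mult_ac)
      also have "\<dots> = (\<Sum>h\<in>H. \<Sum>k\<in>H. \<Sum>\<alpha>\<in>?D. f (x \<otimes>\<^bsub>G\<^esub> h) * cnj (g (x \<otimes>\<^bsub>G\<^esub> k)) * (\<alpha> h * cnj (\<alpha> k)))"
        by (subst sum.swap, intro sum.cong refl, rule sum.swap)
      also have "\<dots> = (\<Sum>h\<in>H. \<Sum>k\<in>H. if h = k then of_nat (card H) * (f (x \<otimes>\<^bsub>G\<^esub> h) * cnj (g (x \<otimes>\<^bsub>G\<^esub> k))) else 0)"
        by (intro sum.cong refl) (simp add: sum_distrib_left [symmetric] dual_orth)
      also have "\<dots> = of_nat (card H) * (\<Sum>h\<in>H. f (x \<otimes>\<^bsub>G\<^esub> h) * cnj (g (x \<otimes>\<^bsub>G\<^esub> h)))"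
        using finH by (simp add: sum_distrib_left)
      finally show ?thesis .
    qed
    have "vinner ?W (?Z f) (?Z g) = (1 / of_nat (card H)) * (\<Sum>x\<in>\<Omega>. \<Sum>\<alpha>\<in>?D. ?Z f \<alpha> x * cnj (?Z g \<alpha> x))"
      by (simp add: L2_defs cardD sum.swap[of _ ?D])
    also have "\<dots> = (\<Sum>x\<in>\<Omega>. \<Sum>h\<in>H. f (x \<otimes>\<^bsub>G\<^esub> h) * cnj (g (x \<otimes>\<^bsub>G\<^esub> h)))"
      using H0 by (simp add: fiber sum_distrib_left [symmetric])
    also have "\<dots> = (\<Sum>(x, h)\<in>\<Omega> \<times> H. f (x \<otimes>\<^bsub>G\<^esub> h) * cnj (g (x \<otimes>\<^bsub>G\<^esub> h)))"
      by (rule sum.cartesian_product)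
    also have "\<dots> = (\<Sum>y\<in>carrier G. f y * cnj (g y))"
      using sum.reindex_bij_betw[OF bij, of "\<lambda>y. f y * cnj (g y)"] by (simp add: case_prod_unfold)
    finally show ?thesis by (simp add: L2_defs)
  qed

  have linear: "linear_between ?V ?W ?Z"
    unfolding linear_between_def
    by (auto simp: L2_defs right_zak_def mem sum.distrib distrib_right sum_distrib_left mult.assoc
             intro!: restrict_ext sum.cong)

  have inj: "inj_on ?Z (carrier ?V)"
  proof (rule inj_onI)
    fix f g assume fg: "f \<in> carrier ?V" "g \<in> carrier ?V" "?Z f = ?Z g"
    \<comment> \<open>The transform of the difference vanishes, so by \<open>inner\<close> its
      squared norm is 0. This gives agreement on \<open>carrier G\<close>, and extensionality gives
      equality.\<close>
    let ?d = "\<lambda>y. f y - g y"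
    have "?Z ?d \<alpha> x = 0" if "\<alpha> \<in> ?D" "x \<in> \<Omega>" for \<alpha> x
      using that fg(3) Z_apply[OF that, of f] Z_apply[OF that, of g]
      by (simp add: Z_apply left_diff_distrib sum_subtractf)
    then have "vinner ?V ?d ?d = 0"
      unfolding inner [symmetric] by (simp add: L2_defs)
    moreover have "of_real (\<Sum>y\<in>carrier G. (cmod (?d y))\<^sup>2) = vinner ?V ?d ?d"
      unfolding of_real_sum complex_norm_square by (simp add: L2_def)
    ultimately have "(\<Sum>y\<in>carrier G. (cmod (?d y))\<^sup>2) = 0"
      by (simp only: of_real_eq_0_iff)
    then have "\<forall>y\<in>carrier G. f y = g y"
      using assms(2) by (subst (asm) sum_nonneg_eq_0_iff) auto
    then show "f = g"
      using fg by (auto simp: L2_defs intro: extensionalityI)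
  qed

  have surj: "\<exists>f\<in>carrier ?V. ?Z f = \<phi>" if \<phi>: "\<phi> \<in> carrier ?W" for \<phi>
  proof -
    \<comment> \<open>Fourier inversion on each fibre, in coordinates
      \<open>\<Omega> \<times> H\<close>; the constant offsets the factor \<open>card H\<close> in
      \<open>orth\<close>. The function \<open>f\<close> then carries \<open>u\<close> over to
      \<open>carrier G\<close>.\<close>
    define u where "u = (\<lambda>(x, h). (1 / of_nat (card H)) * (\<Sum>\<alpha>\<in>?D. \<phi> \<alpha> x * cnj (\<alpha> h)))"
    define f where "f = (\<lambda>y\<in>carrier G. u (inv_into (\<Omega> \<times> H) (\<lambda>(x, h). x \<otimes>\<^bsub>G\<^esub> h) y))"
    have f_apply: "f (x \<otimes>\<^bsub>G\<^esub> h) = u (x, h)" if "x \<in> \<Omega>" "h \<in> H" for x h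
      using bij_betw_inv_into_left[OF bij, of "(x, h)"] that by (simp add: f_def mem)
    have "?Z f \<beta> x = \<phi> \<beta> x" if \<beta>: "\<beta> \<in> ?D" and x: "x \<in> \<Omega>" for \<beta> x
    proof -
      have "?Z f \<beta> x = (1 / of_nat (card H)) * (\<Sum>h\<in>H. \<Sum>\<alpha>\<in>?D. \<phi> \<alpha> x * (\<beta> h * cnj (\<alpha> h)))"
        using \<beta> x by (simp add: Z_apply f_apply u_def sum_distrib_left sum_distrib_right mult_ac)
      also have "(\<Sum>h\<in>H. \<Sum>\<alpha>\<in>?D. \<phi> \<alpha> x * (\<beta> h * cnj (\<alpha> h))) =
          (\<Sum>\<alpha>\<in>?D. if \<beta> = \<alpha> then of_nat (card H) * \<phi> \<alpha> x else 0)"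
        by (subst sum.swap) (intro sum.cong refl, simp add: sum_distrib_left [symmetric] orth \<beta>)
      also have "\<dots> = of_nat (card H) * \<phi> \<beta> x"
        using \<beta> K.finite_dual_group[OF finK] by simp
      finally show ?thesis using H0 by simp
    qed
    then have "?Z f \<beta> = \<phi> \<beta>" if "\<beta> \<in> ?D" for \<beta>
      using that \<phi> by (intro extensionalityI[of _ \<Omega>]) (auto simp: L2_defs right_zak_def PiE_iff)
    then have "?Z f = \<phi>"
      using \<phi> by (intro extensionalityI[of _ ?D]) (auto simp: L2_defs right_zak_def PiE_iff)
    moreover have "f \<in> carrier ?V" by (simp add: f_def L2_defs)
    ultimately show ?thesis by blast
  qed

  have "bij_betw ?Z (carrier ?V) (carrier ?W)"
    using inj surj linear unfolding bij_betw_def linear_between_def by blast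
  then have "unitary ?V ?W ?Z" using linear inner by (simp add: unitary_def)

  moreover have "?Z (right_translation G h f) = modulation G H \<Omega> h (?Z f)" if h: "h \<in> H" for h f
  proof -
    have "(\<Sum>k\<in>H. right_translation G h f (x \<otimes>\<^bsub>G\<^esub> k) * \<alpha> k) = cnj (\<alpha> h) * (\<Sum>k\<in>H. f (x \<otimes>\<^bsub>G\<^esub> k) * \<alpha> k)"
      if \<alpha>: "\<alpha> \<in> ?D" and x: "x \<in> \<Omega>" for \<alpha> x
    proof -
      have inv_h: "inv\<^bsub>G\<^esub> h \<in> H" and hG: "h \<in> carrier G"
        using subgroup.m_inv_closed[OF assms(3)] h sub by auto
      \<comment> \<open>Replacing \<open>k\<close> by \<open>k \<otimes> h\<close> turns
        \<open>f (x \<otimes> k)\<close> into the translated value; the extra factor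
        \<alpha>\<open>(h)\<close> cancels against its conjugate.\<close>
      have "bij_betw (\<lambda>k. k \<otimes>\<^bsub>G\<^esub> h) H H"
        by (rule bij_betw_byWitness[where f' = "\<lambda>k. k \<otimes>\<^bsub>G\<^esub> inv\<^bsub>G\<^esub> h"])
           (use inv_h h hG sub subgroup.m_closed[OF assms(3)] in \<open>auto simp: m_assoc subset_iff\<close>)
      then have "(\<Sum>k\<in>H. f (x \<otimes>\<^bsub>G\<^esub> k) * (cnj (\<alpha> h) * \<alpha> k)) =
          (\<Sum>k\<in>H. f (x \<otimes>\<^bsub>G\<^esub> (k \<otimes>\<^bsub>G\<^esub> h)) * (cnj (\<alpha> h) * \<alpha> (k \<otimes>\<^bsub>G\<^esub> h)))"
        by (rule sum.reindex_bij_betw [symmetric])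
      also have "\<dots> = (\<Sum>k\<in>H. right_translation G h f (x \<otimes>\<^bsub>G\<^esub> k) * \<alpha> k)"
      proof (rule sum.cong)
        fix k assume k: "k \<in> H"
        have "cnj (\<alpha> h) * \<alpha> (k \<otimes>\<^bsub>G\<^esub> h) = \<alpha> k * (\<alpha> h * cnj (\<alpha> h))"
          using \<alpha> h k by (simp add: dual_group_carrier_iff mult_ac)
        also have "\<alpha> h * cnj (\<alpha> h) = 1"
          using \<alpha> h by (simp add: dual_group_carrier_iff complex_norm_square [symmetric])
        finally show "f (x \<otimes>\<^bsub>G\<^esub> (k \<otimes>\<^bsub>G\<^esub> h)) * (cnj (\<alpha> h) * \<alpha> (k \<otimes>\<^bsub>G\<^esub> h)) = right_translation G h f (x \<otimes>\<^bsub>G\<^esub> k) * \<alpha> k"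
          using k x h sub by (simp add: right_translation_def mem m_assoc subset_iff)
      qed simp
      finally show ?thesis by (simp add: sum_distrib_left mult_ac)
    qed
    then show ?thesis
      by (auto simp: modulation_def right_zak_def L2_defs intro!: restrict_ext)
  qed
  ultimately show ?thesis by blast
qed

end
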